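(* Let $d,m$ be positive integers and let $h\colon \Delta_{m-1} \to \mathbb{R}^{d-1}$ be a continuous map. Let $A_1, \dots, A_m \subset S^d$ be closed sets such that $A_i \cap (-A_i) = \emptyset$ for all $i \in [m]$ and $\bigcup_i A_i \cup \bigcup_i (-A_i) = S^d$. Then there are disjoint faces $\sigma$ and $\tau$ of $\Delta_{m-1}$ such that \[h(\sigma) \cap h(\tau) \neq \emptyset \quad \text{and} \quad \bigcap_{i \in \sigma} A_i \cap \bigcap_{i \in \tau} (-A_i) \neq \emptyset.\]
   Context: $\Delta_{m-1} = \{x\in \mathbb{R}^m \mid x_i \ge 0 \text{ for all } i,\ \sum_i x_i = 1\}$ is the standard simplex, whose vertices are the standard basis vectors $e_1,\dots,e_m$, identified with $[m]$; a face of $\Delta_{m-1}$ is identified with the set of indices of its vertices, so $i\in\sigma$ means $e_i$ is a vertex of $\sigma$. *)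

theory Defs
  imports "HOL-Homology.Homology"
begin

text \<open>Points of Euclidean space are functions \<open>nat \<Rightarrow> real\<close> vanishing beyond the dimension, so that
  dimension \<open>0\<close> is available. Coordinates and vertices are indexed from \<open>0\<close>: the simplex
  \<open>standard_simplex p\<close> has the vertices \<open>0, \<dots>, p\<close>, and a face of it is identified with a
  subset of \<open>{..p}\<close>.\<close>

definition simplex_vertex :: "nat \<Rightarrow> nat \<Rightarrow> real" where
  "simplex_vertex i = (\<lambda>j. if j = i then 1 else 0)"

definition simplex_face :: "nat \<Rightarrow> nat set \<Rightarrow> (nat \<Rightarrow> real) set" where
  "simplex_face p S = {x \<in> standard_simplex p. \<forall>i. i \<notin> S \<longrightarrow> x i = 0}"

definition antipodal_set :: "(nat \<Rightarrow> real) set \<Rightarrow> (nat \<Rightarrow> real) set" where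
  "antipodal_set B = (\<lambda>x i. - x i) ` B"

lemma simplex_vertex_in_face_iff:
  assumes "i \<le> p"
  shows "simplex_vertex i \<in> simplex_face p S \<longleftrightarrow> i \<in> S"
  using assms by (auto simp: simplex_face_def simplex_vertex_def standard_simplex_def)

lemma simplex_face_convex_combinations:
  assumes S: "S \<subseteq> {..p}"
  shows "simplex_face p S =
    {\<lambda>j. \<Sum>i\<in>S. c i * simplex_vertex i j | c. (\<forall>i\<in>S. 0 \<le> c i) \<and> sum c S = 1}" (is "?L = ?R")
proof -
  have fin: "finite S" using S finite_subset by blast
  have comb: "(\<Sum>i\<in>S. c i * simplex_vertex i j) = (if j \<in> S then c j else 0)" for c :: "nat \<Rightarrow> real" and j
    using fin by (simp add: simplex_vertex_def if_distrib cong: if_cong)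
  show ?thesis
  proof (intro equalityI subsetI)
    fix x assume x: "x \<in> ?L"
    then have "sum x {..p} = sum x S"
      using S by (intro sum.mono_neutral_right) (auto simp: simplex_face_def)
    moreover have "x = (\<lambda>j. \<Sum>i\<in>S. x i * simplex_vertex i j)"
      unfolding comb using x by (auto simp: simplex_face_def)
    moreover have "sum x {..p} = 1" "\<forall>i\<in>S. 0 \<le> x i"
      using x by (simp_all add: simplex_face_def standard_simplex_def)
    ultimately show "x \<in> ?R"
      unfolding mem_Collect_eq by metis
  next
    fix x assume "x \<in> ?R"
    then obtain c where c: "\<forall>i\<in>S. 0 \<le> c i" "sum c S = 1"
      and x: "x = (\<lambda>j. if j \<in> S then c j else 0)"
      unfolding comb by blast
    have "c i \<le> 1" if "i \<in> S" for i
      using member_le_sum[of i S c] that c fin by auto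
    then have "\<forall>i. 0 \<le> x i \<and> x i \<le> 1"
      using c(1) by (simp add: x)
    moreover have "sum x {..p} = 1"
      using S c(2) by (simp add: x sum.If_cases Int_absorb1)
    moreover have "\<forall>i>p. x i = 0" "\<forall>i. i \<notin> S \<longrightarrow> x i = 0"
      using S unfolding x by auto
    ultimately show "x \<in> ?L"
      unfolding simplex_face_def standard_simplex_def by blast
  qed
qed

lemma simplex_face_disjoint_iff:
  assumes "S \<subseteq> {..p}" "T \<subseteq> {..p}"
  shows "simplex_face p S \<inter> simplex_face p T = {} \<longleftrightarrow> S \<inter> T = {}"
proof
  assume "simplex_face p S \<inter> simplex_face p T = {}"
  then show "S \<inter> T = {}"
    using assms simplex_vertex_in_face_iff by blast
next
  assume "S \<inter> T = {}"
  then have "x i = 0" if "x \<in> simplex_face p S" "x \<in> simplex_face p T" for x i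
    using that by (auto simp: simplex_face_def)
  moreover have "sum x {..p} = 1" if "x \<in> simplex_face p S" for x
    using that by (simp add: simplex_face_def standard_simplex_def)
  ultimately have False if "x \<in> simplex_face p S" "x \<in> simplex_face p T" for x
    using that by (metis sum.neutral zero_neq_one)
  then show "simplex_face p S \<inter> simplex_face p T = {}"
    by blast
qed

end

theory Submission
  imports Defs "HOL-Library.Multiset"
begin

text \<open>
  A partition of unity subordinate to \<open>\<epsilon>\<close>-neighbourhoods of the sets \<open>A\<^sub>i\<close> and \<open>-A\<^sub>i\<close> gives weights
  \<open>\<phi>\<^sub>i(x)\<close> with \<open>\<Sum>\<^sub>i \<phi>\<^sub>i(x) + \<Sum>\<^sub>i \<phi>\<^sub>i(-x) = 1\<close>. With \<open>s = \<Sum>\<^sub>i \<phi>\<^sub>i\<close> and a map \<open>P\<close> into the simplex that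
  equals \<open>2\<phi>\<close> where \<open>s = 1/2\<close>, the map \<open>x \<mapsto> (s(x) - s(-x), h(P(x)) - h(P(-x)))\<close> is an odd map from
  the \<open>d\<close>-sphere to \<open>d\<close>-space. At a zero of it, the supports of \<open>\<phi>(x)\<close> and \<open>\<phi>(-x)\<close> are the wanted
  faces up to \<open>\<epsilon>\<close>, and compactness removes \<open>\<epsilon>\<close>.

  The Borsuk--Ulam theorem is proved by Fan's parity argument on singular chains. As the sphere has
  no reduced homology below \<open>d\<close>, there are chains with \<open>c\<^sub>0\<close> a point and
  \<open>\<partial>c\<^bsub>k+1\<^esub> = c\<^sub>k \<plusminus> (-1)\<^sub># c\<^sub>k\<close>, and they may be subdivided to be small. For an antipodal labelling of
  points by \<open>\<plusminus>1, \<dots>, \<plusminus>d\<close> in which nearby points never have opposite labels, the number of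
  simplices of \<open>c\<^sub>k\<close> whose labels alternate in sign when sorted by absolute value has a parity
  independent of \<open>k\<close>. It is odd for \<open>k = 0\<close>, but \<open>d + 1\<close> labels cannot alternate.
\<close>

section \<open>Alternating label sequences\<close>

fun alternating :: "bool \<Rightarrow> bool list \<Rightarrow> bool" where
  "alternating b [] = True"
| "alternating b (x # xs) = (x = b \<and> alternating (\<not> b) xs)"

definition drop_nth :: "nat \<Rightarrow> 'a list \<Rightarrow> 'a list" where
  "drop_nth k xs = take k xs @ drop (Suc k) xs"

lemma drop_nth_Cons_0 [simp]: "drop_nth 0 (x # xs) = xs"
  by (simp add: drop_nth_def)

lemma drop_nth_Cons_Suc [simp]: "drop_nth (Suc k) (x # xs) = x # drop_nth k xs"
  by (simp add: drop_nth_def)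

lemma map_drop_nth: "map f (drop_nth k xs) = drop_nth k (map f xs)"
  by (simp add: drop_nth_def take_map drop_map)

lemma mset_drop_nth:
  assumes "k < length xs"
  shows "mset (drop_nth k xs) = mset xs - {#xs ! k#}"
proof -
  have "mset xs = mset (take k xs @ xs ! k # drop (Suc k) xs)"
    using assms by (simp add: id_take_nth_drop[symmetric])
  then show ?thesis
    by (simp add: drop_nth_def)
qed

lemma sorted_drop_nth:
  assumes "sorted xs"
  shows "sorted (drop_nth k xs)"
  using assms
proof (induction xs arbitrary: k)
  case (Cons x xs)
  have "set (drop_nth j xs) \<subseteq> set xs" for j
    by (auto simp: drop_nth_def dest: in_set_takeD in_set_dropD)
  then show ?case
    using Cons by (cases k) auto
qed (simp add: drop_nth_def)

lemma drop_nth_map_upt: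
  assumes "k \<le> n"
  shows "drop_nth k (map f [0..<Suc n]) = map (\<lambda>i. f (if i < k then i else Suc i)) [0..<n]"
proof (rule nth_equalityI)
  show "length (drop_nth k (map f [0..<Suc n])) =
    length (map (\<lambda>i. f (if i < k then i else Suc i)) [0..<n])"
    using assms by (simp add: drop_nth_def min_def)
next
  fix i assume "i < length (drop_nth k (map f [0..<Suc n]))"
  then have "i < n"
    using assms by (simp add: drop_nth_def min_def split: if_splits)
  then show "drop_nth k (map f [0..<Suc n]) ! i = map (\<lambda>i. f (if i < k then i else Suc i)) [0..<n] ! i"
    using assms by (auto simp: drop_nth_def nth_append min_def nth_Cons' simp del: upt_Suc)
qed

text \<open>An alternating list has exactly one deletion that leaves an alternating list starting
  with \<open>b\<close>, and it is at an end; for any other list the number of such deletions is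
  even. In the induction, deleting the head leaves \<open>xs\<close>, while deleting a later entry
  requires \<open>x = b\<close> and falls under the hypothesis for \<open>\<not> b\<close>.\<close>

lemma even_sum_alternating_drop_nth:
  assumes "bs \<noteq> []"
  shows "even ((\<Sum>k<length bs. of_bool (alternating b (drop_nth k bs))) -
               (of_bool (alternating True bs) + of_bool (alternating False bs) :: int))"
  using assms
proof (induction bs arbitrary: b)
  case (Cons x xs)
  show ?case
  proof (cases "xs = []")
    case True
    then show ?thesis by (cases x) auto
  next
    case False
    have eq: "(\<Sum>k<length (x # xs). of_bool (alternating b (drop_nth k (x # xs)))) =
       of_bool (alternating b xs) +
       (if x = b then \<Sum>k<length xs. of_bool (alternating (\<not> b) (drop_nth k xs)) else 0 :: int)"
      by (simp add: sum.lessThan_Suc_shift del: sum.lessThan_Suc)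
    show ?thesis
      unfolding eq using Cons.IH[OF False, of "\<not> b"]
      by (cases x; cases b) auto
  qed
qed simp

text \<open>The labels \<open>2i\<close> and \<open>2i + 1\<close> stand for the opposite labels \<open>-(i + 1)\<close> and \<open>i + 1\<close>.\<close>

definition alternating_labels :: "bool \<Rightarrow> nat list \<Rightarrow> bool" where
  "alternating_labels b xs = alternating b (map odd (sort xs))"

text \<open>The sum over all deletions depends only on the multiset of entries. Hence
  \<open>xs\<close> may be replaced by \<open>sort xs\<close>, where each deletion leaves a sorted
  list and the statement on parities applies.\<close>

lemma even_sum_alternating_labels_drop_nth:
  assumes "xs \<noteq> []"
  shows "even ((\<Sum>k<length xs. of_bool (alternating_labels b (drop_nth k xs))) -
               (of_bool (alternating_labels True xs) + of_bool (alternating_labels False xs) :: int))"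
proof -
  define f where "f M = (of_bool (alternating b (map odd (sorted_list_of_multiset M))) :: int)" for M :: "nat multiset"
  have f: "f (mset ys) = of_bool (alternating_labels b ys)" for ys
    by (simp add: f_def alternating_labels_def)
  have sum_f: "(\<Sum>k<length ys. f (mset (drop_nth k ys))) = (\<Sum>y\<in>#mset ys. f (mset ys - {#y#}))" for ys
  proof -
    have "(\<Sum>k<length ys. f (mset (drop_nth k ys))) = (\<Sum>k<length ys. f (mset ys - {#ys ! k#}))"
      by (simp add: mset_drop_nth)
    also have "\<dots> = sum_list (map (\<lambda>y. f (mset ys - {#y#})) ys)"
      by (simp add: sum_list_sum_nth atLeast0LessThan)
    finally show ?thesis
      by (simp flip: sum_mset_sum_list)
  qed
  have "(\<Sum>k<length xs. of_bool (alternating_labels b (drop_nth k xs))) =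
    (\<Sum>k<length xs. f (mset (drop_nth k xs)))"
    by (simp add: f)
  also have "\<dots> = (\<Sum>k<length (sort xs). f (mset (drop_nth k (sort xs))))"
    unfolding sum_f by simp
  also have "\<dots> = (\<Sum>k<length (map odd (sort xs)). of_bool (alternating b (drop_nth k (map odd (sort xs)))))"
    by (simp add: f alternating_labels_def map_drop_nth sort_key_id_if_sorted sorted_drop_nth sorted_sort_id)
  finally have eq: "(\<Sum>k<length xs. of_bool (alternating_labels b (drop_nth k xs))) =
    (\<Sum>k<length (map odd (sort xs)). of_bool (alternating b (drop_nth k (map odd (sort xs)))) :: int)" .
  have "map odd (sort xs) \<noteq> []"
    using assms by (metis length_0_conv length_map length_sort)
  then show ?thesis
    unfolding eq unfolding alternating_labels_def by (rule even_sum_alternating_drop_nth)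
qed

section \<open>Exchanging labels for their opposites\<close>

definition flip_label :: "nat \<Rightarrow> nat" where
  "flip_label n = (if even n then Suc n else n - 1)"

lemma flip_label_div_2 [simp]: "flip_label n div 2 = n div 2"
  by (auto simp: flip_label_def elim!: evenE oddE)

lemma odd_flip_label [simp]: "odd (flip_label n) \<longleftrightarrow> even n"
  by (auto simp: flip_label_def)

lemma alternating_map_Not: "alternating b (map (\<lambda>x. \<not> f x) xs) \<longleftrightarrow> alternating (\<not> b) (map f xs)"
  by (induction xs arbitrary: b) auto

text \<open>Flipping only swaps \<open>2i\<close> with \<open>2i + 1\<close>. When no opposite
  labels occur together, distinct labels are already ordered by \<open>x div 2\<close>, which
  flipping preserves.\<close>

lemma sorted_map_flip_label:
  assumes "sorted xs" and "\<And>x y. x \<in> set xs \<Longrightarrow> y \<in> set xs \<Longrightarrow> x div 2 = y div 2 \<Longrightarrow> x = y"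
  shows "sorted (map flip_label xs)"
  unfolding sorted_map
proof (rule sorted_wrt_mono_rel[OF _ assms(1)])
  fix x y assume xy: "x \<in> set xs" "y \<in> set xs" "x \<le> y"
  show "flip_label x \<le> flip_label y"
  proof (cases "x div 2 = y div 2")
    case False
    then have "flip_label x div 2 < flip_label y div 2"
      using xy(3) by (simp add: div_le_mono le_neq_implies_less)
    then show ?thesis
      by (metis div_le_mono le_cases not_le)
  qed (use xy assms(2) in auto)
qed

lemma alternating_labels_map_flip_label:
  assumes "\<And>x y. x \<in> set xs \<Longrightarrow> y \<in> set xs \<Longrightarrow> x div 2 = y div 2 \<Longrightarrow> x = y"
  shows "alternating_labels b (map flip_label xs) \<longleftrightarrow> alternating_labels (\<not> b) xs"
proof -
  have "sort (map flip_label xs) = map flip_label (sort xs)"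
    using assms by (intro properties_for_sort sorted_map_flip_label) auto
  then show ?thesis
    by (simp add: alternating_labels_def comp_def alternating_map_Not)
qed

text \<open>Equal labels would be adjacent after sorting and have the same parity, so the labels are
  distinct. Without opposite pairs their absolute values are distinct too, and only \<open>d\<close>
  values are available.\<close>

lemma length_alternating_labels_le:
  assumes "alternating_labels b xs" and "\<And>x. x \<in> set xs \<Longrightarrow> x div 2 < d"
    and "\<And>x y. x \<in> set xs \<Longrightarrow> y \<in> set xs \<Longrightarrow> x div 2 = y div 2 \<Longrightarrow> x = y"
  shows "length xs \<le> d"
proof -
  have dist: "distinct ys" if "sorted ys" "alternating b (map odd ys)" for b and ys :: "nat list"
    using that
  proof (induction ys arbitrary: b)
    case (Cons y ys)
    then have "distinct ys" by auto
    moreover have "y \<notin> set ys"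
    proof (cases ys)
      case (Cons z zs)
      then have "y \<noteq> z" "y \<le> z" "\<forall>u\<in>set ys. z \<le> u"
        using Cons.prems by auto
      then show ?thesis by fastforce
    qed simp
    ultimately show ?case by simp
  qed simp
  have "distinct xs"
    using dist[of "sort xs" b] assms(1) by (simp add: alternating_labels_def)
  then have "length xs = card (set xs)"
    by (simp add: distinct_card)
  also have "\<dots> = card ((\<lambda>x. x div 2) ` set xs)"
    using assms(3) by (intro card_image[symmetric]) (auto simp: inj_on_def)
  also have "\<dots> \<le> card {..<d}"
    using assms(2) by (intro card_mono) auto
  finally show ?thesis by simp
qed

section \<open>Antipodal chains on the sphere\<close>

text \<open>The reduced homology of the sphere vanishes below degree \<open>d\<close>. In degree 0
  the reduced group is the kernel of the map to a point, whence the condition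
  \<open>aug\<close>.\<close>

lemma nsphere_cycle_imp_boundary:
  assumes "p < d" and z: "singular_relcycle p (nsphere d) {} z"
    and aug: "p = 0 \<Longrightarrow> chain_map 0 (\<lambda>x. ()) z = 0"
  obtains c where "singular_chain (Suc p) (nsphere d) c" "chain_boundary (Suc p) c = z"
proof -
  let ?H = "homology_group (int p) (nsphere d)"
  let ?z = "homologous_rel_set p (nsphere d) {} z"
  have zH: "?z \<in> carrier ?H"
    using z by (simp add: carrier_relative_homology_group)
  have "?z \<in> carrier (reduced_homology_group (int p) (nsphere d))"
  proof (cases "p = 0")
    case True
    have "hom_induced (int p) (nsphere d) {} (discrete_topology {()}) {} (\<lambda>x. ()) ?z =
        homologous_rel_set p (discrete_topology {()}) {} 0"
      using hom_induced_chain_map[of "nsphere d" "discrete_topology {()}" "\<lambda>x. ()" "{}" "{}" p z] z aug True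
      by simp
    also have "\<dots> = \<one>\<^bsub>homology_group (int p) (discrete_topology {()})\<^esub>"
      by (simp add: homologous_rel_set_eq_relboundary)
    finally show ?thesis
      using zH by (simp add: carrier_reduced_homology_group kernel_def)
  qed (use zH in \<open>simp add: un_reduced_homology_group\<close>)
  moreover have "trivial_group (reduced_homology_group (int p) (nsphere d))"
    using \<open>p < d\<close> by (simp add: trivial_reduced_homology_group_nsphere)
  ultimately have "?z = \<one>\<^bsub>?H\<^esub>"
    by (simp add: trivial_group_def one_reduced_homology_group del: one_relative_homology_group)
  then have "singular_relboundary p (nsphere d) {} z"
    by (simp add: homologous_rel_set_eq_relboundary)
  then show thesis
    using that by (auto simp: singular_boundary)
qed

abbreviation antipode :: "(nat \<Rightarrow> real) \<Rightarrow> nat \<Rightarrow> real" where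
  "antipode \<equiv> \<lambda>x i. - x i"

lemma continuous_map_nsphere_antipode: "continuous_map (nsphere d) (nsphere d) antipode"
proof -
  have "continuous_map (nsphere d) euclideanreal (\<lambda>x. - x k)" for k
    using continuous_map_nsphere_projection by (rule continuous_map_minus)
  then show ?thesis
    by (auto simp: nsphere continuous_map_in_subtopology continuous_map_componentwise_UNIV)
qed

lemma antipode_in_nsphere: "x \<in> topspace (nsphere d) \<Longrightarrow> antipode x \<in> topspace (nsphere d)"
  using continuous_map_nsphere_antipode continuous_map_image_subset_topspace by blast

lemma chain_map_antipode_antipode:
  assumes "singular_chain p X c"
  shows "chain_map p antipode (chain_map p antipode c) = c"
proof -
  have "chain_map p (antipode \<circ> antipode) c = c"
    using chain_map_id_gen[OF assms, of "antipode \<circ> antipode"] by simp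
  then show ?thesis
    by (simp add: chain_map_compose)
qed

text \<open>The sign is the one that makes \<open>antipodal_sum\<close> send a solution of
  \<open>\<partial>c' = antipodal_sum p c\<close> to a cycle again.\<close>

definition antipodal_sum :: "nat \<Rightarrow> (nat \<Rightarrow> real) chain \<Rightarrow> (nat \<Rightarrow> real) chain" where
  "antipodal_sum p c = c + frag_cmul ((-1) ^ Suc p) (chain_map p antipode c)"

lemma singular_chain_antipodal_sum:
  "singular_chain p (nsphere d) c \<Longrightarrow> singular_chain p (nsphere d) (antipodal_sum p c)"
  unfolding antipodal_sum_def
  by (intro singular_chain_add singular_chain_cmul
      singular_chain_chain_map[OF _ continuous_map_nsphere_antipode])

text \<open>Write \<open>a\<close> for the antipode on chains. The signs in consecutive degrees are
  opposite, so the two sums compose to (1 + a)(1 - a) = 1 - a^2, which is 0 as a is an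
  involution.\<close>

lemma chain_boundary_antipodal_sum:
  assumes c: "singular_chain p (nsphere d) c"
    and c': "singular_chain (Suc p) (nsphere d) c'" "chain_boundary (Suc p) c' = antipodal_sum p c"
  shows "chain_boundary (Suc p) (antipodal_sum (Suc p) c') = 0"
proof -
  have "chain_boundary (Suc p) (antipodal_sum (Suc p) c') =
    antipodal_sum p c + frag_cmul ((-1) ^ Suc (Suc p)) (chain_map p antipode (antipodal_sum p c))"
    using chain_boundary_chain_map[OF c'(1), of antipode] c'(2)
    by (simp add: antipodal_sum_def[of "Suc p"] chain_boundary_add chain_boundary_cmul
        del: power_Suc)
  also have "\<dots> = 0"
    unfolding antipodal_sum_def chain_map_add chain_map_cmul chain_map_antipode_antipode[OF c]
    by (cases "even p") simp_all
  finally show ?thesis .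
qed

lemma antipodal_chains_exist:
  assumes f: "singular_simplex 0 (nsphere d) f"
  obtains c where "c 0 = frag_of f" "\<And>p. singular_chain p (nsphere d) (c p)"
    "\<And>p. p < d \<Longrightarrow> chain_boundary (Suc p) (c (Suc p)) = antipodal_sum p (c p)"
proof -
  \<comment> \<open>The invariant includes that the antipodal sum is a cycle, which is what the next
    filling needs. Above degree \<open>d\<close> this is dropped, so the zero chain can continue the
    sequence.\<close>
  define P where "P p c \<longleftrightarrow> singular_chain p (nsphere d) c \<and> (p = 0 \<longrightarrow> c = frag_of f) \<and>
    (p \<le> d \<longrightarrow> chain_boundary p (antipodal_sum p c) = 0)" for p c
  have "\<exists>c. \<forall>p. P p (c p) \<and> (p < d \<longrightarrow> chain_boundary (Suc p) (c (Suc p)) = antipodal_sum p (c p))"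
  proof (rule dependent_nat_choice)
    show "\<exists>c. P 0 c"
      using f by (auto simp: P_def singular_chain_of chain_boundary_def)
  next
    fix c p assume c: "P p c"
    show "\<exists>c'. P (Suc p) c' \<and> (p < d \<longrightarrow> chain_boundary (Suc p) c' = antipodal_sum p c)"
    proof (cases "p < d")
      case True
      have "singular_relcycle p (nsphere d) {} (antipodal_sum p c)"
        using c True singular_chain_antipodal_sum by (simp add: P_def singular_cycle)
      \<comment> \<open>The two points of \<open>antipodal_sum 0 (frag_of f)\<close> have opposite
        signs and cancel over a one-point space.\<close>
      moreover have "chain_map 0 (\<lambda>x. ()) (antipodal_sum p c) = 0" if "p = 0"
        using c that by (simp add: P_def antipodal_sum_def chain_map_diff simplex_map_def comp_def restrict_def)
      ultimately obtain c' where "singular_chain (Suc p) (nsphere d) c'" 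
          "chain_boundary (Suc p) c' = antipodal_sum p c"
        using nsphere_cycle_imp_boundary[OF True] by metis
      then show ?thesis
        using c chain_boundary_antipodal_sum by (auto simp: P_def)
    next
      case False
      then show ?thesis
        by (intro exI[of _ 0]) (auto simp: P_def)
    qed
  qed
  then show thesis
    using that by (auto simp: P_def)
qed

section \<open>Subdivision of antipodal chains\<close>

lemma singular_chain_subdivision_power:
  "singular_chain p X c \<Longrightarrow> singular_chain p X ((singular_subdivision p ^^ n) c)"
  by (induction n) (auto simp: singular_chain_singular_subdivision)

lemma chain_map_subdivision_power:
  "singular_chain p X c \<Longrightarrow>
    (singular_subdivision p ^^ n) (chain_map p g c) = chain_map p g ((singular_subdivision p ^^ n) c)"
  by (induction n)
     (auto simp: naturality_singular_subdivision[OF singular_chain_subdivision_power])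

lemma chain_boundary_subdivision_power:
  "singular_chain p X c \<Longrightarrow> chain_boundary p ((singular_subdivision p ^^ n) c) =
    (singular_subdivision (p - Suc 0) ^^ n) (chain_boundary p c)"
  by (induction n)
     (auto simp: chain_boundary_singular_subdivision[OF singular_chain_subdivision_power])

lemma singular_subdivision_cmul:
  "singular_subdivision p (frag_cmul a c) = frag_cmul a (singular_subdivision p c)"
  by (simp add: singular_subdivision_def frag_extend_cmul)

lemma antipodal_sum_subdivision_power:
  assumes "singular_chain p X c"
  shows "(singular_subdivision p ^^ n) (antipodal_sum p c) =
    antipodal_sum p ((singular_subdivision p ^^ n) c)"
proof -
  have "(singular_subdivision p ^^ n) (a + frag_cmul k b) =
    (singular_subdivision p ^^ n) a + frag_cmul k ((singular_subdivision p ^^ n) b)" for k and a b :: "(nat \<Rightarrow> real) chain"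
    by (induction n) (simp_all add: singular_subdivision_add singular_subdivision_cmul)
  then show ?thesis
    by (simp add: antipodal_sum_def chain_map_subdivision_power[OF assms] del: power_Suc)
qed

lemma small_antipodal_chains_exist:
  assumes f: "singular_simplex 0 (nsphere d) f"
    and \<C>: "\<And>U. U \<in> \<C> \<Longrightarrow> openin (nsphere d) U" "topspace (nsphere d) \<subseteq> \<Union>\<C>"
  obtains c where "c 0 = frag_of f" "\<And>p. singular_chain p (nsphere d) (c p)"
    "\<And>p. p < d \<Longrightarrow> chain_boundary (Suc p) (c (Suc p)) = antipodal_sum p (c p)"
    "\<And>p g. p \<le> d \<Longrightarrow> g \<in> Poly_Mapping.keys (c p) \<Longrightarrow> \<exists>V\<in>\<C>. g \<in> standard_simplex p \<rightarrow> V"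
proof -
  obtain c where c0: "c 0 = frag_of f" and c: "\<And>p. singular_chain p (nsphere d) (c p)"
    and bd: "\<And>p. p < d \<Longrightarrow> chain_boundary (Suc p) (c (Suc p)) = antipodal_sum p (c p)"
    using antipodal_chains_exist[OF f] by metis
  have "\<exists>n. \<forall>m g. n \<le> m \<longrightarrow> g \<in> Poly_Mapping.keys ((singular_subdivision p ^^ m) (c p)) \<longrightarrow>
      (\<exists>V\<in>\<C>. g \<in> standard_simplex p \<rightarrow> V)" for p
    using sufficient_iterated_singular_subdivision_exists[OF \<C> c, of p] by metis
  then obtain n where n: "\<And>p m g. n p \<le> m \<Longrightarrow>
      g \<in> Poly_Mapping.keys ((singular_subdivision p ^^ m) (c p)) \<Longrightarrow>
      \<exists>V\<in>\<C>. g \<in> standard_simplex p \<rightarrow> V"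
    by metis
  \<comment> \<open>The boundary relations link consecutive degrees, so all chains must be
    subdivided equally often. The relations survive because subdivision commutes with the boundary
    and with the antipode.\<close>
  define N where "N = Max (n ` {..d})"
  have N: "n p \<le> N" if "p \<le> d" for p
    using that by (simp add: N_def)
  define c' where "c' p = (singular_subdivision p ^^ N) (c p)" for p
  show thesis
  proof (rule that)
    have "(singular_subdivision 0 ^^ k) (c 0) = c 0" for k
      by (induction k) (simp_all add: singular_subdivision_zero[OF c])
    then show "c' 0 = frag_of f"
      by (simp add: c'_def c0)
    show "singular_chain p (nsphere d) (c' p)" for p
      unfolding c'_def using c by (rule singular_chain_subdivision_power)
    show "chain_boundary (Suc p) (c' (Suc p)) = antipodal_sum p (c' p)" if "p < d" for p
      using chain_boundary_subdivision_power[OF c, of "Suc p" N] bd[OF that]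
      by (simp add: c'_def antipodal_sum_subdivision_power[OF c])
    show "\<exists>V\<in>\<C>. g \<in> standard_simplex p \<rightarrow> V" if "p \<le> d" "g \<in> Poly_Mapping.keys (c' p)" for p g
      using n[OF N] that by (simp add: c'_def)
  qed
qed

section \<open>The Borsuk--Ulam theorem\<close>

text \<open>This is the sum of the coefficients of the simplices satisfying \<open>P\<close>.
  Passing through the free abelian group on one generator makes it additive by the rules for
  \<open>frag_extend\<close>.\<close>

definition chain_count :: "(((nat \<Rightarrow> real) \<Rightarrow> 'a) \<Rightarrow> bool) \<Rightarrow> 'a chain \<Rightarrow> int" where
  "chain_count P c = Poly_Mapping.lookup (frag_extend (\<lambda>f. if P f then frag_of () else 0) c) ()"

lemma chain_count_0 [simp]: "chain_count P 0 = 0"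
  by (simp add: chain_count_def)

lemma chain_count_of [simp]: "chain_count P (frag_of f) = of_bool (P f)"
  by (simp add: chain_count_def)

lemma chain_count_add: "chain_count P (a + b) = chain_count P a + chain_count P b"
  by (simp add: chain_count_def frag_extend_add lookup_add)

lemma chain_count_diff: "chain_count P (a - b) = chain_count P a - chain_count P b"
  by (simp add: chain_count_def frag_extend_diff lookup_minus)

lemma chain_count_cmul: "chain_count P (frag_cmul k c) = k * chain_count P c"
  by (simp add: chain_count_def frag_extend_cmul)

lemma chain_count_sum: "chain_count P (sum g I) = (\<Sum>i\<in>I. chain_count P (g i))"
  by (induction I rule: infinite_finite_induct) (simp_all add: chain_count_add)

lemma chain_count_eq_0:
  assumes "\<And>f. f \<in> Poly_Mapping.keys c \<Longrightarrow> \<not> P f"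
  shows "chain_count P c = 0"
proof -
  have "frag_extend (\<lambda>f. if P f then frag_of () else 0) c = 0"
    unfolding frag_extend_def using assms by (intro sum.neutral) auto
  then show ?thesis
    by (simp add: chain_count_def)
qed

lemma chain_count_chain_map:
  assumes "\<And>f. f \<in> Poly_Mapping.keys c \<Longrightarrow> P (simplex_map p g f) \<longleftrightarrow> Q f"
  shows "chain_count P (chain_map p g c) = chain_count Q c"
proof -
  have "Poly_Mapping.keys c \<subseteq> {f. P (simplex_map p g f) \<longleftrightarrow> Q f}"
    using assms by auto
  then show ?thesis
    by (induction c rule: frag_induction) (simp_all add: chain_map_diff chain_count_diff)
qed

section \<open>Labels at the vertices of singular simplices\<close>

definition vertex_labels :: "('a \<Rightarrow> nat) \<Rightarrow> nat \<Rightarrow> ((nat \<Rightarrow> real) \<Rightarrow> 'a) \<Rightarrow> nat list" where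
  "vertex_labels l p f = map (\<lambda>i. l (f (simplex_vertex i))) [0..<Suc p]"

lemma simplex_vertex_in_standard_simplex [simp]: "simplex_vertex i \<in> standard_simplex p \<longleftrightarrow> i \<le> p"
  by (simp add: simplex_vertex_def)

lemma simplical_face_simplex_vertex:
  "simplical_face k (simplex_vertex i) = simplex_vertex (if i < k then i else Suc i)"
  by (auto simp: simplical_face_def simplex_vertex_def fun_eq_iff)

lemma vertex_labels_singular_face:
  assumes "k \<le> Suc p"
  shows "vertex_labels l p (singular_face (Suc p) k f) = drop_nth k (vertex_labels l (Suc p) f)"
  unfolding vertex_labels_def drop_nth_map_upt[OF assms]
  by (auto simp: singular_face_def simplical_face_simplex_vertex simp del: upt_Suc)

lemma vertex_labels_simplex_map:
  "vertex_labels l p (simplex_map p g f) = map (\<lambda>i. l (g (f (simplex_vertex i)))) [0..<Suc p]"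
  by (auto simp: vertex_labels_def simplex_map_def)

definition alternating_count :: "('a \<Rightarrow> nat) \<Rightarrow> bool \<Rightarrow> nat \<Rightarrow> 'a chain \<Rightarrow> int" where
  "alternating_count l b p c = chain_count (\<lambda>f. alternating_labels b (vertex_labels l p f)) c"

text \<open>The signs of the boundary disappear modulo 2, and faces correspond to deletions from the
  list of vertex labels. So the claim for one simplex is the statement on deletions, and additivity
  extends it to chains.\<close>

lemma even_alternating_count_chain_boundary:
  "even (alternating_count l b p (chain_boundary (Suc p) c) -
         (alternating_count l True (Suc p) c + alternating_count l False (Suc p) c))"
  using subset_UNIV
proof (induction c rule: frag_induction)
  case (one f)
  let ?a = "\<lambda>k. of_bool (alternating_labels b (drop_nth k (vertex_labels l (Suc p) f))) :: int"
  let ?N = "alternating_count l True (Suc p) (frag_of f) + alternating_count l False (Suc p) (frag_of f)"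
  have "alternating_count l b p (chain_boundary (Suc p) (frag_of f)) = (\<Sum>k\<le>Suc p. (-1) ^ k * ?a k)"
    by (simp add: alternating_count_def chain_boundary_of chain_count_sum chain_count_cmul
        vertex_labels_singular_face del: sum.atMost_Suc power_Suc)
  moreover have "even ((\<Sum>k\<le>Suc p. (-1) ^ k * ?a k) - (\<Sum>k\<le>Suc p. ?a k))"
    unfolding sum_subtractf[symmetric] by (intro dvd_sum) auto
  moreover have "even ((\<Sum>k\<le>Suc p. ?a k) - ?N)"
    using even_sum_alternating_labels_drop_nth[of "vertex_labels l (Suc p) f" b]
    by (simp add: alternating_count_def vertex_labels_def lessThan_Suc_atMost
        del: upt_Suc sum.atMost_Suc sum_of_bool_eq)
  ultimately show ?case
    by (smt (verit) dvd_add)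
next
  case (diff a b)
  then show ?case
    unfolding chain_boundary_diff alternating_count_def chain_count_diff
    by (smt (verit) dvd_diff)
qed (simp add: alternating_count_def)

text \<open>The cover expresses nearness: chains subdivided until each simplex lies in one member of
  \<C> carry no opposite labels on a simplex, so the parity argument applies.\<close>

lemma no_antipodal_labelling:
  fixes l :: "(nat \<Rightarrow> real) \<Rightarrow> nat"
  assumes \<C>: "\<And>U. U \<in> \<C> \<Longrightarrow> openin (nsphere d) U" "topspace (nsphere d) \<subseteq> \<Union>\<C>"
    and no_compl: "\<And>U x y. U \<in> \<C> \<Longrightarrow> x \<in> U \<Longrightarrow> y \<in> U \<Longrightarrow> l x div 2 = l y div 2 \<Longrightarrow> l x = l y"
    and flip: "\<And>x. x \<in> topspace (nsphere d) \<Longrightarrow> l (antipode x) = flip_label (l x)"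
    and less: "\<And>x. x \<in> topspace (nsphere d) \<Longrightarrow> l x div 2 < d"
  shows False
proof -
  define f where "f = restrict (\<lambda>_. \<lambda>n::nat. if n = 0 then 1 else 0 :: real) (standard_simplex 0)"
  have "singular_simplex 0 (nsphere d) f"
    using in_topspace_nsphere by (simp add: f_def singular_simplex_def)
  then obtain c where c0: "c 0 = frag_of f" and c: "\<And>p. singular_chain p (nsphere d) (c p)"
    and bd: "\<And>p. p < d \<Longrightarrow> chain_boundary (Suc p) (c (Suc p)) = antipodal_sum p (c p)"
    and small: "\<And>p g. p \<le> d \<Longrightarrow> g \<in> Poly_Mapping.keys (c p) \<Longrightarrow> \<exists>V\<in>\<C>. g \<in> standard_simplex p \<rightarrow> V"
    using small_antipodal_chains_exist[OF _ \<C>] by metis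
  have sph: "g (simplex_vertex i) \<in> topspace (nsphere d)"
    if "g \<in> Poly_Mapping.keys (c p)" "i \<le> p" for g p i
  proof -
    have "singular_simplex p (nsphere d) g"
      using c[of p] that(1) by (auto simp: singular_chain_def)
    then have "g \<in> standard_simplex p \<rightarrow> topspace (nsphere d)"
      by (simp add: singular_simplex_def continuous_map_def)
    then show ?thesis
      using that(2) by auto
  qed
  have inj: "u = v" if p: "p \<le> d" and g: "g \<in> Poly_Mapping.keys (c p)" and uv: "u div 2 = v div 2"
    "u \<in> set (vertex_labels l p g)" "v \<in> set (vertex_labels l p g)" for p g u v
  proof -
    obtain V where V: "V \<in> \<C>" "g \<in> standard_simplex p \<rightarrow> V"
      using small p g by blast
    obtain i j where "i \<le> p" "j \<le> p" "u = l (g (simplex_vertex i))" "v = l (g (simplex_vertex j))"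
      using uv(2,3) by (auto simp: vertex_labels_def less_Suc_eq_le simp del: upt_Suc)
    moreover from this have "g (simplex_vertex i) \<in> V" "g (simplex_vertex j) \<in> V"
      by (simp_all add: Pi_mem[OF V(2)])
    ultimately show ?thesis
      using no_compl[OF V(1), of "g (simplex_vertex i)" "g (simplex_vertex j)"] uv(1) by simp
  qed
  define E where "E b p = alternating_count l b p (c p)" for b p
  \<comment> \<open>The antipode flips every label and thus exchanges the two possible first
    signs.\<close>
  have anti: "alternating_count l b p (chain_map p antipode (c p)) = E (\<not> b) p" if "p \<le> d" for b p
    unfolding E_def alternating_count_def
  proof (rule chain_count_chain_map)
    fix g assume g: "g \<in> Poly_Mapping.keys (c p)"
    have "vertex_labels l p (simplex_map p antipode g) = map flip_label (vertex_labels l p g)"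
      unfolding vertex_labels_simplex_map unfolding vertex_labels_def
      using flip sph[OF g] by (simp add: less_Suc_eq_le del: upt_Suc)
    then show "alternating_labels b (vertex_labels l p (simplex_map p antipode g)) =
        alternating_labels (\<not> b) (vertex_labels l p g)"
      using inj[OF that g] by (simp add: alternating_labels_map_flip_label)
  qed
  \<comment> \<open>Counting the simplices of \<open>antipodal_sum p (c p)\<close> that start with
    \<open>True\<close> gives \<open>E True p\<close> plus or minus \<open>E False p\<close>. Since
    that chain is the boundary of \<open>c (Suc p)\<close>, the count has the parity of
    \<open>E True (Suc p) + E False (Suc p)\<close>.\<close>
  have "odd (E True p + E False p)" if "p \<le> d" for p
    using that
  proof (induction p)
    case 0
    have "E b 0 = of_bool (b = odd (l (f (simplex_vertex 0))))" for b
      by (auto simp: E_def alternating_count_def c0 alternating_labels_def vertex_labels_def)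
    then show ?case by auto
  next
    case (Suc p)
    have "alternating_count l True p (antipodal_sum p (c p)) = E True p + (-1) ^ Suc p * E False p"
      using anti[of p True] Suc.prems
      by (simp add: antipodal_sum_def alternating_count_def chain_count_add chain_count_cmul E_def
          del: power_Suc)
    moreover have "even (alternating_count l True p (antipodal_sum p (c p)) - (E True (Suc p) + E False (Suc p)))"
      using even_alternating_count_chain_boundary[of l True p "c (Suc p)"] bd Suc.prems
      by (simp add: E_def)
    ultimately show ?case
      using Suc by (cases "even p") auto
  qed
  moreover have "E b d = 0" for b
    unfolding E_def alternating_count_def
  proof (rule chain_count_eq_0)
    fix g assume g: "g \<in> Poly_Mapping.keys (c d)"
    show "\<not> alternating_labels b (vertex_labels l d g)"
    proof
      assume *: "alternating_labels b (vertex_labels l d g)"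
      have "u div 2 < d" if "u \<in> set (vertex_labels l d g)" for u
        using that less sph[OF g] by (auto simp: vertex_labels_def less_Suc_eq_le simp del: upt_Suc)
      then have "length (vertex_labels l d g) \<le> d"
        using length_alternating_labels_le[OF *] inj[OF order_refl g] by blast
      then show False
        by (simp add: vertex_labels_def)
    qed
  qed
  ultimately show False
    by (metis add.right_neutral even_zero order_refl)
qed

text \<open>A map without zeros can be scaled so that its absolute coordinates sum to 1. Some
  coordinate is then at least \<open>1 / d\<close> in absolute value, and its index and sign give a
  forbidden labelling.\<close>

theorem Borsuk_Ulam_nsphere:
  fixes F :: "nat \<Rightarrow> (nat \<Rightarrow> real) \<Rightarrow> real"
  assumes cont: "\<And>i. i < d \<Longrightarrow> continuous_map (nsphere d) euclideanreal (F i)"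
    and odd: "\<And>i x. i < d \<Longrightarrow> x \<in> topspace (nsphere d) \<Longrightarrow> F i (antipode x) = - F i x"
  shows "\<exists>x\<in>topspace (nsphere d). \<forall>i<d. F i x = 0"
proof (rule ccontr)
  let ?S = "topspace (nsphere d)"
  assume "\<not> ?thesis"
  then have nz: "\<exists>i<d. F i x \<noteq> 0" if "x \<in> ?S" for x
    using that by blast
  define s where "s x = (\<Sum>i<d. \<bar>F i x\<bar>)" for x
  have s_pos: "0 < s x" if "x \<in> ?S" for x
  proof -
    obtain i where "i < d" "F i x \<noteq> 0"
      using nz \<open>x \<in> ?S\<close> by blast
    then show ?thesis
      unfolding s_def by (intro sum_pos2[of _ i]) auto
  qed
  define G where "G i x = F i x / s x" for i x
  have contG: "continuous_map (nsphere d) euclideanreal (G i)" if "i < d" for i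
  proof -
    have "continuous_map (nsphere d) euclideanreal s"
      unfolding s_def using cont by (intro continuous_map_sum continuous_map_real_abs) auto
    moreover have "s x \<noteq> 0" if "x \<in> ?S" for x
      using s_pos[OF that] by simp
    ultimately show ?thesis
      unfolding G_def using cont[OF that] by (intro continuous_map_real_divide) auto
  qed
  have G_odd: "G i (antipode x) = - G i x" if "i < d" "x \<in> ?S" for i x
  proof -
    have "s (antipode x) = s x"
      using odd that by (simp add: s_def)
    then show ?thesis
      using odd that by (simp add: G_def)
  qed
  have G_large: "\<exists>i<d. 1 / real d \<le> \<bar>G i x\<bar>" if x: "x \<in> ?S" for x
  proof (rule ccontr)
    assume "\<not> ?thesis"
    then have "\<And>i. i < d \<Longrightarrow> \<bar>G i x\<bar> < 1 / real d"
      by (simp add: not_le)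
    moreover have "0 < d"
      using nz[OF x] by auto
    ultimately have "(\<Sum>i<d. \<bar>G i x\<bar>) < (\<Sum>i<d. 1 / real d)"
      by (intro sum_strict_mono) auto
    moreover have "(\<Sum>i<d. \<bar>G i x\<bar>) = 1"
      using s_pos[OF x] by (simp add: G_def s_def flip: sum_divide_distrib)
    ultimately show False
      using \<open>0 < d\<close> by simp
  qed
  \<comment> \<open>Taking the least index of a large coordinate depends only on absolute values, so
    antipodal points get the same index.\<close>
  define idx where "idx x = (LEAST i. i < d \<and> 1 / real d \<le> \<bar>G i x\<bar>)" for x
  have idx: "idx x < d" "1 / real d \<le> \<bar>G (idx x) x\<bar>" if "x \<in> ?S" for x
    using LeastI_ex[OF G_large[OF that]] by (simp_all add: idx_def)
  define l where "l x = 2 * idx x + of_bool (0 < G (idx x) x)" for x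
  have l_div: "l x div 2 = idx x" for x
    by (simp add: l_def)
  \<comment> \<open>With this radius, two points of \<open>V y\<close> differ by less than
    \<open>2 / d\<close> in each coordinate, so a coordinate that is large at both has the same
    sign.\<close>
  define V where "V y = {x \<in> ?S. \<forall>i<d. \<bar>G i x - G i y\<bar> < 1 / real d}" for y
  have openV: "openin (nsphere d) (V y)" for y
  proof -
    have "openin (nsphere d) {x \<in> ?S. \<bar>G i x - G i y\<bar> \<in> {..<1 / real d}}" if "i < d" for i
      using contG[OF that]
      by (intro openin_continuous_map_preimage[of _ euclideanreal] continuous_map_real_abs continuous_map_diff) auto
    then have "openin (nsphere d)
        ((\<Inter>i\<in>{..<d}. {x \<in> ?S. \<bar>G i x - G i y\<bar> \<in> {..<1 / real d}}) \<inter> ?S)"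
      by (intro openin_INT) auto
    also have "(\<Inter>i\<in>{..<d}. {x \<in> ?S. \<bar>G i x - G i y\<bar> \<in> {..<1 / real d}}) \<inter> ?S = V y"
      by (auto simp: V_def)
    finally show ?thesis .
  qed
  show False
  proof (rule no_antipodal_labelling[of "V ` ?S" d l])
    show "openin (nsphere d) U" if "U \<in> V ` ?S" for U
      using that openV by auto
    show "?S \<subseteq> \<Union> (V ` ?S)"
    proof
      fix x assume x: "x \<in> ?S"
      then have "0 < d" using nz[OF x] by auto
      then have "x \<in> V x"
        using x by (simp add: V_def)
      then show "x \<in> \<Union> (V ` ?S)"
        using x by blast
    qed
    show "l x = l y" if U: "U \<in> V ` ?S" "x \<in> U" "y \<in> U" and xy: "l x div 2 = l y div 2" for U x y
    proof -
      obtain z where z: "x \<in> V z" "y \<in> V z"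
        using U by auto
      have i: "idx x = idx y"
        using xy by (simp add: l_div)
      have "x \<in> ?S" "y \<in> ?S"
        using z by (auto simp: V_def)
      then have "\<bar>G (idx x) x - G (idx x) z\<bar> < 1 / real d" "\<bar>G (idx x) y - G (idx x) z\<bar> < 1 / real d"
          "1 / real d \<le> \<bar>G (idx x) x\<bar>" "1 / real d \<le> \<bar>G (idx x) y\<bar>"
        using z idx[of x] idx[of y] i by (auto simp: V_def)
      then have "0 < G (idx x) x \<longleftrightarrow> 0 < G (idx x) y"
        by linarith
      then show ?thesis
        by (simp add: l_def i)
    qed
    show "l (antipode x) = flip_label (l x)" if x: "x \<in> ?S" for x
    proof -
      have i: "idx (antipode x) = idx x"
        unfolding idx_def using G_odd[OF _ x] by (intro arg_cong[of _ _ Least]) (auto simp: fun_eq_iff)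
      moreover have "G (idx x) x \<noteq> 0"
        using idx[OF x] by auto
      ultimately show ?thesis
        using G_odd[OF idx(1) x] x by (auto simp: l_def flip_label_def)
    qed
    show "l x div 2 < d" if "x \<in> ?S" for x
      using idx[OF that] by (simp add: l_div)
  qed
qed

section \<open>From odd maps to disjoint faces\<close>

text \<open>This links the sphere to the type class topology on functions, where
  \<open>continuous_on\<close>, \<open>compact\<close> and \<open>infdist\<close> are
  available.\<close>

lemma nsphere_eq_top_of_set: "nsphere d = top_of_set (topspace (nsphere d))"
  by (simp add: nsphere euclidean_product_topology)

lemma continuous_map_nsphere_euclidean_iff:
  "continuous_map (nsphere d) euclidean f \<longleftrightarrow> continuous_on (topspace (nsphere d)) f"
  by (subst nsphere_eq_top_of_set) simp

text \<open>The sphere is closed in an infinite product of intervals, which is compact by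
  Tychonoff.\<close>

lemma compact_topspace_nsphere: "compact (topspace (nsphere d))"
proof -
  let ?B = "PiE UNIV (\<lambda>i::nat. {-1..1::real})"
  have sub: "topspace (nsphere d) \<subseteq> ?B"
  proof (intro subsetI PiE_I)
    fix x and i :: nat
    assume "x \<in> topspace (nsphere d)"
    then have x: "(\<Sum>i\<le>d. (x i)\<^sup>2) = 1" "\<forall>i>d. x i = 0"
      by (auto simp: nsphere)
    have "(x i)\<^sup>2 \<le> 1"
    proof (cases "i \<le> d")
      case True
      then have "(x i)\<^sup>2 \<le> (\<Sum>i\<le>d. (x i)\<^sup>2)"
        by (intro member_le_sum) auto
      then show ?thesis using x by simp
    qed (use x in auto)
    then have "\<bar>x i\<bar> \<le> 1"
      by (simp add: abs_square_le_1)
    then show "x i \<in> {-1..1}" by auto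
  qed auto
  have "compactin (powertop_real UNIV) ?B"
    by (simp add: compactin_PiE)
  then have "compact ?B"
    by (simp add: euclidean_product_topology)
  moreover have "closed (topspace (nsphere d))"
  proof -
    have "topspace (nsphere d) = {x. (\<Sum>i\<le>d. (x i)\<^sup>2) = 1} \<inter> (\<Inter>i\<in>{d<..}. {x. x i = 0})"
      by (auto simp: nsphere)
    moreover have "closed {x :: nat \<Rightarrow> real. (\<Sum>i\<le>d. (x i)\<^sup>2) = 1}"
      by (intro closed_Collect_eq continuous_intros continuous_on_product_coordinates)
    moreover have "closed {x :: nat \<Rightarrow> real. x i = 0}" for i
      by (intro closed_Collect_eq continuous_intros continuous_on_product_coordinates)
    ultimately show ?thesis
      by (simp add: closed_Int closed_INT)
  qed
  ultimately show ?thesis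
    using sub by (metis compact_Int_closed inf.absorb_iff2)
qed

lemma continuous_on_antipode: "continuous_on S antipode"
  by (intro continuous_on_coordinatewise_then_product continuous_intros
      continuous_on_subset[OF continuous_on_product_coordinates]) auto

lemma antipodal_set_iff: "x \<in> antipodal_set B \<longleftrightarrow> antipode x \<in> B"
proof
  assume "antipode x \<in> B"
  then have "antipode (antipode x) \<in> antipodal_set B"
    unfolding antipodal_set_def by (rule imageI)
  then show "x \<in> antipodal_set B" by simp
qed (auto simp: antipodal_set_def)

section \<open>Coincidence up to \<epsilon>\<close>

lemma approximate_coincidence:
  fixes A :: "nat \<Rightarrow> (nat \<Rightarrow> real) set"
  assumes "0 < d" and "0 < m"
    and h: "continuous_map (subtopology (powertop_real UNIV) (standard_simplex (m - 1)))
           (Euclidean_space (d - 1)) h"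
    and cover: "topspace (nsphere d) \<subseteq> (\<Union>i<m. A i) \<union> (\<Union>i<m. antipodal_set (A i))"
    and "0 < \<epsilon>"
  obtains x \<sigma> \<tau> where "x \<in> topspace (nsphere d)" "\<sigma> \<subseteq> {..<m}" "\<tau> \<subseteq> {..<m}"
    "h ` simplex_face (m - 1) \<sigma> \<inter> h ` simplex_face (m - 1) \<tau> \<noteq> {}"
    "\<And>i. i \<in> \<sigma> \<Longrightarrow> A i \<noteq> {} \<and> infdist x (A i) < \<epsilon>"
    "\<And>i. i \<in> \<tau> \<Longrightarrow> A i \<noteq> {} \<and> infdist (antipode x) (A i) < \<epsilon>"
proof -
  let ?S = "topspace (nsphere d)"
  \<comment> \<open>The empty set needs its own case because \<open>infdist x {} = 0\<close>.\<close>
  define u where "u i x = (if A i = {} then 0 else max 0 (\<epsilon> - infdist x (A i)))" for i x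
  define t where "t x = (\<Sum>i<m. u i x + u i (antipode x))" for x
  define \<phi> where "\<phi> i x = u i x / t x" for i x
  define s where "s x = (\<Sum>i<m. \<phi> i x)" for x
  \<comment> \<open>The maximum keeps the denominator positive where \<open>s\<close> vanishes.
    \<open>P\<close> puts the missing mass \<open>1 - s x / M x\<close> on vertex 0; where
    \<open>s x = 1/2\<close> there is none, and \<open>P x\<close> is twice \<phi>.\<close>
  define M where "M x = max (s x) (1/2)" for x
  define P where "P x j = (if j < m then \<phi> j x / M x + (if j = 0 then 1 - s x / M x else 0) else 0)" for x j
  have u_nonneg: "0 \<le> u i x" for i x
    by (simp add: u_def)
  have t_pos: "0 < t x" if x: "x \<in> ?S" for x
  proof -
    obtain i where i: "i < m" "x \<in> A i \<or> antipode x \<in> A i"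
      using cover x by (auto simp: antipodal_set_iff)
    then have "0 < u i x + u i (antipode x)"
      using u_nonneg[of i x] u_nonneg[of i "antipode x"] \<open>0 < \<epsilon>\<close>
      by (auto simp: u_def infdist_zero)
    then show ?thesis
      unfolding t_def using i(1) u_nonneg by (intro sum_pos2[of _ i]) auto
  qed
  have t_antipode: "t (antipode x) = t x" for x
    by (simp add: t_def add.commute)
  have \<phi>_nonneg: "0 \<le> \<phi> i x" if "x \<in> ?S" for i x
    using t_pos[OF that] u_nonneg by (simp add: \<phi>_def)
  have s_nonneg: "0 \<le> s x" if "x \<in> ?S" for x
    using \<phi>_nonneg that by (auto simp: s_def intro: sum_nonneg)
  have s_antipode: "s x + s (antipode x) = 1" if "x \<in> ?S" for x
  proof -
    have "s x + s (antipode x) = ((\<Sum>i<m. u i x) + (\<Sum>i<m. u i (antipode x))) / t x"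
      by (simp add: s_def \<phi>_def t_antipode sum_divide_distrib add_divide_distrib)
    also have "\<dots> = t x / t x"
      by (simp add: t_def sum.distrib)
    finally show ?thesis
      using t_pos[OF that] by simp
  qed
  have M_pos: "0 < M x" "s x \<le> M x" for x
    by (auto simp: M_def)
  have P_simplex: "P x \<in> standard_simplex (m - 1)" if x: "x \<in> ?S" for x
  proof -
    have nonneg: "0 \<le> P x j" for j
      using \<phi>_nonneg[OF x] M_pos[of x] by (auto simp: P_def)
    have "sum (P x) {..m - 1} = (\<Sum>j<m. \<phi> j x / M x + (if j = 0 then 1 - s x / M x else 0))"
      using \<open>0 < m\<close> by (intro sum.cong) (auto simp: P_def)
    also have "\<dots> = 1"
      using \<open>0 < m\<close> by (simp add: sum.distrib s_def flip: sum_divide_distrib)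
    finally have sum: "sum (P x) {..m - 1} = 1" .
    have "P x j \<le> 1" for j
    proof (cases "j \<le> m - 1")
      case True
      then show ?thesis
        using member_le_sum[of j "{..m - 1}" "P x"] nonneg sum by auto
    qed (use \<open>0 < m\<close> in \<open>auto simp: P_def\<close>)
    moreover have "P x j = 0" if "j > m - 1" for j
      using that by (auto simp: P_def)
    ultimately show ?thesis
      using nonneg sum by (auto simp: standard_simplex_def)
  qed
  have cont_u: "continuous_on ?S (u i)" for i
    unfolding u_def by (cases "A i = {}") (auto intro!: continuous_intros)
  have cont_u': "continuous_on ?S (\<lambda>x. u i (antipode x))" for i
    using antipode_in_nsphere
    by (intro continuous_on_compose2[OF cont_u continuous_on_antipode]) auto
  have t_nz: "t x \<noteq> 0" if "x \<in> ?S" for x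
    using t_pos[OF that] by simp
  have cont_\<phi>: "continuous_on ?S (\<phi> i)" for i
    unfolding \<phi>_def using t_nz
    by (intro continuous_on_divide cont_u) (auto simp: t_def intro!: continuous_intros cont_u cont_u')
  have cont_s: "continuous_on ?S s"
    unfolding s_def by (intro continuous_intros cont_\<phi>)
  have cont_M: "continuous_on ?S M"
    unfolding M_def by (intro continuous_intros cont_s)
  have "continuous_on ?S (\<lambda>x. P x j)" for j
    unfolding P_def using M_pos(1)
    by (cases "j < m"; cases "j = 0")
       (auto intro!: continuous_intros cont_s cont_M cont_\<phi> simp: less_imp_neq[symmetric])
  then have cont_P: "continuous_map (nsphere d) (subtopology (powertop_real UNIV) (standard_simplex (m - 1))) P"
    using P_simplex
    by (auto simp: continuous_map_in_subtopology continuous_map_componentwise_UNIV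
        continuous_map_nsphere_euclidean_iff)
  have cont_hP: "continuous_map (nsphere d) euclideanreal (\<lambda>x. h (P x) j)" for j
  proof -
    have "continuous_map (subtopology (powertop_real UNIV) (standard_simplex (m - 1)))
        euclideanreal (\<lambda>y. h y j)"
      using h by (auto simp: Euclidean_space_def continuous_map_in_subtopology
          continuous_map_componentwise_UNIV)
    from continuous_map_compose[OF cont_P this] show ?thesis
      by (simp add: comp_def)
  qed
  \<comment> \<open>Coordinate 0 balances \<open>s\<close>, and the remaining \<open>d - 1\<close>
    coordinates compare the images under \<open>h\<close>, shifted by one.\<close>
  define F where "F i x = (if i = 0 then s x - s (antipode x)
      else h (P x) (i - 1) - h (P (antipode x)) (i - 1))" for i x
  have "\<exists>x\<in>?S. \<forall>i<d. F i x = 0"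
  proof (rule Borsuk_Ulam_nsphere)
    have cont_s': "continuous_map (nsphere d) euclideanreal s"
      using cont_s by (simp add: continuous_map_nsphere_euclidean_iff)
    have compose_antipode: "continuous_map (nsphere d) euclideanreal (\<lambda>x. f (antipode x))"
      if "continuous_map (nsphere d) euclideanreal f" for f
      using continuous_map_compose[OF continuous_map_nsphere_antipode that] by (simp add: comp_def)
    show "continuous_map (nsphere d) euclideanreal (F i)" for i
      unfolding F_def
      using continuous_map_diff[OF cont_s' compose_antipode[OF cont_s']]
        continuous_map_diff[OF cont_hP compose_antipode[OF cont_hP]]
      by (cases "i = 0") auto
  qed (auto simp: F_def)
  then obtain x where x: "x \<in> ?S" and zero: "\<And>i. i < d \<Longrightarrow> F i x = 0"
    by blast
  have "s x = s (antipode x)"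
    using zero[OF \<open>0 < d\<close>] by (simp add: F_def)
  then have half: "s x = 1/2" "s (antipode x) = 1/2"
    using s_antipode[OF x] by auto
  have hP_E: "h (P y) \<in> topspace (Euclidean_space (d - 1))" if "y \<in> ?S" for y
    using continuous_map_compose[OF cont_P h] that by (auto simp: continuous_map_def)
  have h_eq: "h (P x) = h (P (antipode x))"
  proof
    fix j
    show "h (P x) j = h (P (antipode x)) j"
    proof (cases "j < d - 1")
      case True
      then show ?thesis
        using zero[of "Suc j"] by (simp add: F_def)
    next
      case False
      then show ?thesis
        using hP_E[OF x] hP_E[OF antipode_in_nsphere[OF x]] by (simp add: topspace_Euclidean_space)
    qed
  qed
  define supp where "supp y = {i. i < m \<and> \<phi> i y \<noteq> 0}" for y
  have face: "P y \<in> simplex_face (m - 1) (supp y)" if "y \<in> ?S" "s y = 1/2" for y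
    using P_simplex[OF that(1)] that(2) by (auto simp: simplex_face_def supp_def P_def M_def)
  have near: "A i \<noteq> {} \<and> infdist y (A i) < \<epsilon>" if "i \<in> supp y" for i y
    using that by (auto simp: supp_def \<phi>_def u_def split: if_splits)
  show thesis
  proof (rule that[of x "supp x" "supp (antipode x)"])
    show "h ` simplex_face (m - 1) (supp x) \<inter> h ` simplex_face (m - 1) (supp (antipode x)) \<noteq> {}"
      using face[OF x half(1)] face[OF antipode_in_nsphere[OF x] half(2)] h_eq by blast
  qed (use x near in \<open>auto simp: supp_def\<close>)
qed

section \<open>Removing \<epsilon> by compactness\<close>

theorem theorem2p5:
  fixes d m :: nat
    and h :: "(nat \<Rightarrow> real) \<Rightarrow> (nat \<Rightarrow> real)"
    and A :: "nat \<Rightarrow> (nat \<Rightarrow> real) set"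
  assumes "0 < d" and "0 < m"
    and "continuous_map (subtopology (powertop_real UNIV) (standard_simplex (m - 1)))
           (Euclidean_space (d - 1)) h"
    and "\<And>i. i < m \<Longrightarrow> closedin (nsphere d) (A i)"
    and "\<And>i. i < m \<Longrightarrow> A i \<inter> antipodal_set (A i) = {}"
    and "(\<Union>i<m. A i) \<union> (\<Union>i<m. antipodal_set (A i)) = topspace (nsphere d)"
  shows "\<exists>\<sigma> \<tau>. \<sigma> \<subseteq> {..<m} \<and> \<tau> \<subseteq> {..<m} \<and> \<sigma> \<inter> \<tau> = {} \<and>
           h ` simplex_face (m - 1) \<sigma> \<inter> h ` simplex_face (m - 1) \<tau> \<noteq> {} \<and>
           (\<Inter>i\<in>\<sigma>. A i) \<inter> (\<Inter>i\<in>\<tau>. antipodal_set (A i)) \<noteq> {}"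
proof -
  let ?S = "topspace (nsphere d)"
  define Q where "Q \<epsilon> \<sigma> \<tau> \<longleftrightarrow> h ` simplex_face (m - 1) \<sigma> \<inter> h ` simplex_face (m - 1) \<tau> \<noteq> {} \<and>
    (\<exists>x\<in>?S. (\<forall>i\<in>\<sigma>. A i \<noteq> {} \<and> infdist x (A i) < \<epsilon>) \<and>
             (\<forall>i\<in>\<tau>. A i \<noteq> {} \<and> infdist (antipode x) (A i) < \<epsilon>))" for \<epsilon> \<sigma> \<tau>
  have Q_ex: "\<exists>\<sigma> \<tau>. \<sigma> \<subseteq> {..<m} \<and> \<tau> \<subseteq> {..<m} \<and> Q \<epsilon> \<sigma> \<tau>" if \<epsilon>: "0 < \<epsilon>" for \<epsilon>
  proof (rule approximate_coincidence[OF assms(1-3) _ \<epsilon>, of A])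
    show "?S \<subseteq> (\<Union>i<m. A i) \<union> (\<Union>i<m. antipodal_set (A i))"
      using assms(6) by simp
  next
    fix x \<sigma> \<tau>
    assume "x \<in> ?S" "\<sigma> \<subseteq> {..<m}" "\<tau> \<subseteq> {..<m}"
      "h ` simplex_face (m - 1) \<sigma> \<inter> h ` simplex_face (m - 1) \<tau> \<noteq> {}"
      "\<And>i. i \<in> \<sigma> \<Longrightarrow> A i \<noteq> {} \<and> infdist x (A i) < \<epsilon>"
      "\<And>i. i \<in> \<tau> \<Longrightarrow> A i \<noteq> {} \<and> infdist (antipode x) (A i) < \<epsilon>"
    then have "\<sigma> \<subseteq> {..<m} \<and> \<tau> \<subseteq> {..<m} \<and> Q \<epsilon> \<sigma> \<tau>"
      unfolding Q_def by (intro conjI bexI[of _ x] ballI) auto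
    then show ?thesis by blast
  qed
  \<comment> \<open>There are finitely many pairs of faces, and \<open>Q\<close> is monotone in
    \<epsilon>. If every pair failed for some \<epsilon>, all would fail for the least of
    these.\<close>
  have "\<exists>\<sigma> \<tau>. \<sigma> \<subseteq> {..<m} \<and> \<tau> \<subseteq> {..<m} \<and> (\<forall>\<epsilon>>0. Q \<epsilon> \<sigma> \<tau>)"
  proof (rule ccontr)
    assume *: "\<not> ?thesis"
    define I where "I = Pow {..<m} \<times> Pow {..<m}"
    have "\<exists>e>0. \<not> Q e (fst p) (snd p)" if "p \<in> I" for p
      using * that by (auto simp: I_def)
    then obtain e where e: "\<And>p. p \<in> I \<Longrightarrow> 0 < e p \<and> \<not> Q (e p) (fst p) (snd p)"
      by metis
    have I: "finite I" "I \<noteq> {}"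
      by (auto simp: I_def)
    then have "0 < Min (e ` I)"
      using e by simp
    then obtain \<sigma> \<tau> where \<sigma>\<tau>: "(\<sigma>, \<tau>) \<in> I" and Q: "Q (Min (e ` I)) \<sigma> \<tau>"
      using Q_ex unfolding I_def by blast
    have "Min (e ` I) \<le> e (\<sigma>, \<tau>)"
      using I \<sigma>\<tau> by simp
    then have "Q (e (\<sigma>, \<tau>)) \<sigma> \<tau>"
      using Q unfolding Q_def by (meson less_le_trans)
    then show False
      using e[OF \<sigma>\<tau>] by simp
  qed
  then obtain \<sigma> \<tau> where sub: "\<sigma> \<subseteq> {..<m}" "\<tau> \<subseteq> {..<m}" and Q: "\<And>\<epsilon>. 0 < \<epsilon> \<Longrightarrow> Q \<epsilon> \<sigma> \<tau>"
    by blast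
  have fin: "finite \<sigma>" "finite \<tau>"
    using sub finite_subset by blast+
  \<comment> \<open>Zero distance gives membership in a closed set only if the set is nonempty, as
    \<open>infdist x {} = 0\<close>.\<close>
  have ne: "A i \<noteq> {}" if "i \<in> \<sigma> \<union> \<tau>" for i
    using Q[of 1] that by (auto simp: Q_def)
  \<comment> \<open>A zero of this total distance lies in all the required sets. The minimum over
    the compact sphere is attained, and \<open>Q\<close> makes the values arbitrarily small.\<close>
  define q where "q x = (\<Sum>i\<in>\<sigma>. infdist x (A i)) + (\<Sum>i\<in>\<tau>. infdist (antipode x) (A i))" for x
  have "continuous_on ?S q"
    unfolding q_def by (intro continuous_intros continuous_on_antipode)
  moreover have "?S \<noteq> {}"
    using in_topspace_nsphere by blast
  ultimately obtain x where x: "x \<in> ?S" and x_min: "\<And>y. y \<in> ?S \<Longrightarrow> q x \<le> q y"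
    using continuous_attains_inf[OF compact_topspace_nsphere] by blast
  have "q x \<le> 0"
  proof (rule ccontr)
    assume "\<not> q x \<le> 0"
    \<comment> \<open>One more than the number of summands: then \<open>q y\<close> is at most
      \<open>(n - 1) * (q x / n)\<close>, strictly below the minimum.\<close>
    define n where "n = real (card \<sigma> + card \<tau>) + 1"
    have n: "0 < n" by (simp add: n_def)
    then obtain y where y: "y \<in> ?S" "\<And>i. i \<in> \<sigma> \<Longrightarrow> infdist y (A i) < q x / n"
        "\<And>i. i \<in> \<tau> \<Longrightarrow> infdist (antipode y) (A i) < q x / n"
      using Q[of "q x / n"] \<open>\<not> q x \<le> 0\<close> by (auto simp: Q_def)
    have "q y \<le> (\<Sum>i\<in>\<sigma>. q x / n) + (\<Sum>i\<in>\<tau>. q x / n)"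
      unfolding q_def[of y] using y by (intro add_mono sum_mono) (auto intro: less_imp_le)
    also have "\<dots> = (n - 1) * (q x / n)"
      by (simp add: n_def algebra_simps add_divide_distrib)
    also have "\<dots> < q x"
      using n \<open>\<not> q x \<le> 0\<close> by (simp add: field_simps)
    finally show False
      using x_min[OF y(1)] by simp
  qed
  moreover have nonneg: "0 \<le> (\<Sum>i\<in>\<sigma>. infdist x (A i))" "0 \<le> (\<Sum>i\<in>\<tau>. infdist (antipode x) (A i))"
    by (simp_all add: sum_nonneg infdist_nonneg)
  ultimately have "(\<Sum>i\<in>\<sigma>. infdist x (A i)) = 0" "(\<Sum>i\<in>\<tau>. infdist (antipode x) (A i)) = 0"
    by (auto simp: q_def)
  then have dist0: "\<And>i. i \<in> \<sigma> \<Longrightarrow> infdist x (A i) = 0" "\<And>i. i \<in> \<tau> \<Longrightarrow> infdist (antipode x) (A i) = 0"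
    using fin by (simp_all add: sum_nonneg_eq_0_iff infdist_nonneg)
  have closed: "closed (A i)" if "i < m" for i
    using assms(4)[OF that] compact_imp_closed[OF compact_topspace_nsphere]
    by (metis closedin_closed_trans nsphere_eq_top_of_set)
  have x_in: "x \<in> A i" if "i \<in> \<sigma>" for i
    using in_closed_iff_infdist_zero[of "A i" x] closed[of i] ne[of i] dist0 that sub by auto
  have x_in': "x \<in> antipodal_set (A i)" if "i \<in> \<tau>" for i
    using in_closed_iff_infdist_zero[of "A i" "antipode x"] closed[of i] ne[of i] dist0 that sub
    by (auto simp: antipodal_set_iff)
  \<comment> \<open>Disjointness appears only in the limit: a common index \<open>i\<close> would
    put \<open>x\<close> into both \<open>A i\<close> and its antipodal set.\<close>
  have "\<sigma> \<inter> \<tau> = {}"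
    using x_in x_in' assms(5) sub by blast
  moreover have "x \<in> (\<Inter>i\<in>\<sigma>. A i) \<inter> (\<Inter>i\<in>\<tau>. antipodal_set (A i))"
    using x_in x_in' by auto
  moreover have "h ` simplex_face (m - 1) \<sigma> \<inter> h ` simplex_face (m - 1) \<tau> \<noteq> {}"
    using Q[of 1] by (simp add: Q_def)
  ultimately show ?thesis
    using sub by blast
qed

end
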